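(* Let $m \ge 6$ be an even integer and let $v_m \ge 0$. For $v_0 \ge 0$, let $\mathcal{A}(v_0)$ denote the truncated Hankel tensor of order $m$ and dimension $3$ with generating vector $\mathbf{v} = (v_0, 0, \ldots, 0, v_m, 0, \ldots, 0, v_0)^\top\in\mathbb{R}^{2m+1}$ (the last entry $v_{2m}$ equals $v_0$). Define $$d_1(m) = \inf\{d>0 : \mathcal{A}(v_0) \text{ is an SOS tensor for all } v_0 \ge 0 \text{ such that } v_0 \ge d\, v_m\},$$ $$d_2(m) = \inf\{d>0 : \mathcal{A}(v_0) \text{ is a PSD tensor for all } v_0 \ge 0 \text{ such that } v_0 \ge d\, v_m\}.$$ Then: (1) $d_2(m) = d_1(m) = 0$ if $v_m = 0$; (2) $0 \le d_2(m) \le d_1(m) < +\infty$ if $v_m > 0$.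
   Context: The Hankel tensor of order $m$ and dimension $3$ with generating vector $\mathbf{v}=(v_0,\ldots,v_{2m})^\top$ is the real symmetric tensor $\mathcal{A}=(a_{i_1\cdots i_m})$ with $a_{i_1\cdots i_m}=v_{i_1+\cdots+i_m-m}$ for $i_1,\ldots,i_m\in\{1,2,3\}$; it is a truncated Hankel tensor if all entries of $\mathbf{v}$ other than $v_0,v_m,v_{2m}$ are zero. Let $f(\mathbf{x})=\sum_{i_1,\ldots,i_m=1}^3 a_{i_1\cdots i_m}x_{i_1}\cdots x_{i_m}$. The tensor $\mathcal{A}$ is PSD if $f(\mathbf{x})\ge 0$ for all $\mathbf{x}\in\mathbb{R}^3$, and (with $m=2k$) SOS if $f$ is a finite sum of squares of real homogeneous polynomials of degree $k$. The infimum of the empty set is $+\infty$. *)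

theory Defs
  imports "HOL-Analysis.Analysis" "HOL-Library.Extended_Real"
begin

(* A tensor of order m and dimension 3 is a function on multi-indices i = (i 1, ..., i m)
   with entries in {1,2,3}; only its values on the following set matter. *)
definition multi_indices :: "nat \<Rightarrow> (nat \<Rightarrow> nat) set" where
  "multi_indices m = {1..m} \<rightarrow>\<^sub>E {1..3}"

(* Vectors in real ^ 3 are indexed by the type 3, whose elements are 1, 2 and 3 (= 0); of_nat
   is a bijection from the set {1..3} of natural numbers onto it. *)
definition tensor_form :: "nat \<Rightarrow> ((nat \<Rightarrow> nat) \<Rightarrow> real) \<Rightarrow> real ^ 3 \<Rightarrow> real" where
  "tensor_form m a x = (\<Sum>i\<in>multi_indices m. a i * (\<Prod>j=1..m. x $ of_nat (i j)))"

definition psd_tensor :: "nat \<Rightarrow> ((nat \<Rightarrow> nat) \<Rightarrow> real) \<Rightarrow> bool" where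
  "psd_tensor m a \<longleftrightarrow> (\<forall>x. tensor_form m a x \<ge> 0)"

(* Real polynomials are identified with the polynomial functions they induce.
   The exponent set is finite, by the lemma below, so the sum is a genuine one. *)
definition homogeneous_polynomial :: "nat \<Rightarrow> (real ^ 3 \<Rightarrow> real) \<Rightarrow> bool" where
  "homogeneous_polynomial k p \<longleftrightarrow>
     (\<exists>c :: (3 \<Rightarrow> nat) \<Rightarrow> real. \<forall>x. p x = (\<Sum>e | sum e UNIV = k. c e * (\<Prod>i\<in>UNIV. (x $ i) ^ e i)))"

lemma finite_exponents: "finite {e :: 3 \<Rightarrow> nat. sum e UNIV = k}"
proof (rule finite_subset)
  show "{e :: 3 \<Rightarrow> nat. sum e UNIV = k} \<subseteq> UNIV \<rightarrow>\<^sub>E {..k}"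
    by (auto intro: member_le_sum)
  show "finite (UNIV \<rightarrow>\<^sub>E {..k} :: (3 \<Rightarrow> nat) set)"
    by (intro finite_PiE) auto
qed

definition sos_tensor :: "nat \<Rightarrow> ((nat \<Rightarrow> nat) \<Rightarrow> real) \<Rightarrow> bool" where
  "sos_tensor m a \<longleftrightarrow>
     (\<exists>k ps. m = 2 * k \<and> (\<forall>p\<in>set ps. homogeneous_polynomial k p) \<and>
       (\<forall>x. tensor_form m a x = (\<Sum>p\<leftarrow>ps. (p x)\<^sup>2)))"

(* On multi_indices m every entry is at least 1, so the subtraction does not truncate. *)
definition hankel_tensor :: "nat \<Rightarrow> (nat \<Rightarrow> real) \<Rightarrow> (nat \<Rightarrow> nat) \<Rightarrow> real" where
  "hankel_tensor m v i = v ((\<Sum>j=1..m. i j) - m)"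

definition truncated_vector :: "nat \<Rightarrow> real \<Rightarrow> real \<Rightarrow> real \<Rightarrow> nat \<Rightarrow> real" where
  "truncated_vector m v0 vm v2m k =
     (if k = 0 then v0 else if k = m then vm else if k = 2 * m then v2m else 0)"

definition \<A> :: "nat \<Rightarrow> real \<Rightarrow> real \<Rightarrow> (nat \<Rightarrow> nat) \<Rightarrow> real" where
  "\<A> m vm v0 = hankel_tensor m (truncated_vector m v0 vm v0)"

(* The infima are taken in the extended reals, where Inf {} = \<infinity>. *)
definition d\<^sub>1 :: "nat \<Rightarrow> real \<Rightarrow> ereal" where
  "d\<^sub>1 m vm = Inf (ereal ` {d. d > 0 \<and> (\<forall>v0\<ge>0. v0 \<ge> d * vm \<longrightarrow> sos_tensor m (\<A> m vm v0))})"

definition d\<^sub>2 :: "nat \<Rightarrow> real \<Rightarrow> ereal" where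
  "d\<^sub>2 m vm = Inf (ereal ` {d. d > 0 \<and> (\<forall>v0\<ge>0. v0 \<ge> d * vm \<longrightarrow> psd_tensor m (\<A> m vm v0))})"

end

theory Submission imports Defs begin

text \<open>Write \<open>m = 2 * k\<close>. The form of the tensor is
  \<open>v\<^sub>0 * (x\<^sub>1 ^ m + x\<^sub>3 ^ m) + v\<^sub>m * (x\<^sub>2 ^ m + R x)\<close>, where \<open>R\<close> is a sum of mixed monomials
  \<open>x\<^sub>1 ^ n * x\<^sub>2 ^ (m - 2 * n) * x\<^sub>3 ^ n\<close> with \<open>n > 0\<close> (\<open>tensor_form_truncated_hankel\<close>,
  \<open>middle_index_monomial\<close>). All assertions follow once some \<open>M \<ge> 0\<close> makes
  \<open>M * (x\<^sub>1 ^ m + x\<^sub>3 ^ m) + x\<^sub>2 ^ m + R x\<close> a sum of squares: if \<open>v\<^sub>0 \<ge> M * v\<^sub>m\<close>, the form of the tensor is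
  \<open>v\<^sub>m\<close> times this one plus a nonnegative multiple of \<open>x\<^sub>1 ^ m + x\<^sub>3 ^ m\<close>. So \<open>d\<^sub>1\<close> is at most
  \<open>M + 1\<close>, and for \<open>v\<^sub>m = 0\<close> every \<open>d > 0\<close> is admissible; sums of squares being nonnegative gives
  \<open>d\<^sub>2 \<le> d\<^sub>1\<close>.

  Such an \<open>M\<close> exists because every mixed monomial contains \<open>x\<^sub>1\<close> and \<open>x\<^sub>3\<close>. Up to sums of squares it is a
  combination of negated squares of monomials, by \<open>2 * u * w = (u + w)\<^sup>2 - u\<^sup>2 - w\<^sup>2\<close>. A negated
  square is compensated by the pure powers through the weighted arithmetic-geometric mean inequality;
  with large weights on \<open>x\<^sub>1\<close> and \<open>x\<^sub>3\<close> this uses an arbitrarily small multiple of \<open>x\<^sub>2 ^ m\<close>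
  (\<open>dominated_neg_square\<close>), so one copy of \<open>x\<^sub>2 ^ m\<close> is enough for all the monomials of \<open>R\<close>. That the
  inequality is itself an identity of sums of squares comes from the factorization of
  \<open>(X ^ p - Y ^ p) * (X ^ q - Y ^ q)\<close> in \<open>sos_form_power_diff_mult_power_diff\<close>.\<close>

section \<open>The cone of sums of squares of forms\<close>

definition sos_form :: "nat \<Rightarrow> (real ^ 3 \<Rightarrow> real) \<Rightarrow> bool" where
  "sos_form k f \<longleftrightarrow>
     (\<exists>ps. (\<forall>p\<in>set ps. homogeneous_polynomial k p) \<and> (\<forall>x. f x = (\<Sum>p\<leftarrow>ps. (p x)\<^sup>2)))"

lemma sos_tensor_iff_sos_form: "sos_tensor (2 * k) a \<longleftrightarrow> sos_form k (tensor_form (2 * k) a)"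
  unfolding sos_tensor_def sos_form_def by auto

lemma homogeneous_polynomial_scale:
  assumes "homogeneous_polynomial k p"
  shows "homogeneous_polynomial k (\<lambda>x. c * p x)"
proof -
  obtain a :: "(3 \<Rightarrow> nat) \<Rightarrow> real"
    where "\<forall>x. p x = (\<Sum>e | sum e UNIV = k. a e * (\<Prod>i\<in>UNIV. (x $ i) ^ e i))"
    using assms unfolding homogeneous_polynomial_def by blast
  then show ?thesis
    unfolding homogeneous_polynomial_def
    by (intro exI[of _ "\<lambda>e. c * a e"]) (simp add: sum_distrib_left mult.assoc)
qed

lemma homogeneous_polynomial_add:
  assumes "homogeneous_polynomial k p" and "homogeneous_polynomial k q"
  shows "homogeneous_polynomial k (\<lambda>x. p x + q x)"
proof -
  obtain a where "\<forall>x. p x = (\<Sum>e | sum e UNIV = k. a e * (\<Prod>i\<in>UNIV. (x $ i) ^ e i))"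
    using assms(1) unfolding homogeneous_polynomial_def by blast
  moreover obtain b where "\<forall>x. q x = (\<Sum>e | sum e UNIV = k. b e * (\<Prod>i\<in>UNIV. (x $ i) ^ e i))"
    using assms(2) unfolding homogeneous_polynomial_def by blast
  ultimately show ?thesis
    unfolding homogeneous_polynomial_def
    by (intro exI[of _ "\<lambda>e. a e + b e"]) (simp add: sum.distrib distrib_right)
qed

text \<open>The indices are allowed to coincide, so that the lemma also covers monomials in one or two
  variables.\<close>

lemma homogeneous_polynomial_monomial:
  fixes i j l :: 3
  assumes "p + q + r = k"
  shows "homogeneous_polynomial k (\<lambda>x. (x $ i) ^ p * (x $ j) ^ q * (x $ l) ^ r)"
proof -
  define d :: "3 \<Rightarrow> nat \<Rightarrow> 3 \<Rightarrow> nat" where "d = (\<lambda>i p n. if n = i then p else 0)"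
  define e where "e = (\<lambda>n. d i p n + d j q n + d l r n)"
  have d_sum: "sum (d i p) UNIV = p" for i p
    by (simp add: d_def)
  have d_prod: "(\<Prod>n\<in>UNIV. (x $ n) ^ d i p n) = (x $ i) ^ p" for x :: "real ^ 3" and i p
  proof -
    have "(\<Prod>n\<in>UNIV. (x $ n) ^ d i p n) = (\<Prod>n\<in>UNIV. if n = i then (x $ n) ^ p else 1)"
      by (intro prod.cong) (auto simp: d_def)
    then show ?thesis by simp
  qed
  have e_sum: "sum e UNIV = k"
    using assms by (simp add: e_def sum.distrib d_sum)
  have "(x $ i) ^ p * (x $ j) ^ q * (x $ l) ^ r = (\<Prod>n\<in>UNIV. (x $ n) ^ e n)" for x :: "real ^ 3"
    by (simp add: e_def power_add prod.distrib d_prod)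
  moreover have "(\<Sum>e' | sum e' UNIV = k. of_bool (e' = e) * (\<Prod>n\<in>UNIV. (x $ n) ^ e' n))
      = (\<Prod>n\<in>UNIV. (x $ n) ^ e n)" for x :: "real ^ 3"
    using e_sum by (subst sum.remove[of _ e]) (auto simp: finite_exponents intro!: sum.neutral)
  ultimately show ?thesis
    unfolding homogeneous_polynomial_def by (intro exI[of _ "\<lambda>e'. of_bool (e' = e)"]) simp
qed

lemma sos_form_square: "homogeneous_polynomial k p \<Longrightarrow> sos_form k (\<lambda>x. (p x)\<^sup>2)"
  unfolding sos_form_def by (intro exI[of _ "[p]"]) simp

lemma sos_form_zero: "sos_form k (\<lambda>x. 0)"
  unfolding sos_form_def by (intro exI[of _ "[]"]) simp

lemma sos_form_add:
  assumes "sos_form k f" and "sos_form k g"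
  shows "sos_form k (\<lambda>x. f x + g x)"
proof -
  obtain ps qs where "\<forall>p\<in>set ps. homogeneous_polynomial k p" "\<forall>x. f x = (\<Sum>p\<leftarrow>ps. (p x)\<^sup>2)"
    and "\<forall>p\<in>set qs. homogeneous_polynomial k p" "\<forall>x. g x = (\<Sum>p\<leftarrow>qs. (p x)\<^sup>2)"
    using assms unfolding sos_form_def by blast
  then show ?thesis
    unfolding sos_form_def by (intro exI[of _ "ps @ qs"]) auto
qed

lemma sos_form_sum:
  "(\<And>i. i \<in> I \<Longrightarrow> sos_form k (f i)) \<Longrightarrow> sos_form k (\<lambda>x. \<Sum>i\<in>I. f i x)"
  by (induction I rule: infinite_finite_induct) (auto simp: sos_form_zero intro: sos_form_add)

lemma sos_form_scale:
  assumes "sos_form k f" and "c \<ge> 0"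
  shows "sos_form k (\<lambda>x. c * f x)"
proof -
  obtain ps where "\<forall>p\<in>set ps. homogeneous_polynomial k p" "\<forall>x. f x = (\<Sum>p\<leftarrow>ps. (p x)\<^sup>2)"
    using assms unfolding sos_form_def by blast
  then show ?thesis
    unfolding sos_form_def using \<open>c \<ge> 0\<close>
    by (intro exI[of _ "map (\<lambda>p x. sqrt c * p x) ps"])
      (auto simp: homogeneous_polynomial_scale power_mult_distrib sum_list_const_mult o_def)
qed

lemma sos_form_even_monomial:
  fixes i j l :: 3
  assumes "p + q + r = k"
  shows "sos_form k (\<lambda>x. (x $ i) ^ (2 * p) * (x $ j) ^ (2 * q) * (x $ l) ^ (2 * r))"
  using sos_form_square[OF homogeneous_polynomial_monomial[OF assms, of i j l]]
  by (simp only: power_mult_distrib power_even_eq)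

lemma sos_form_even_power: "sos_form k (\<lambda>x. (x $ i) ^ (2 * k))"
  using sos_form_even_monomial[of k 0 0 k i i i] by simp

section \<open>Arithmetic-geometric mean inequalities as sums of squares\<close>

text \<open>With \<open>X = t * x\<^sub>i\<^sup>2\<close> and \<open>Y = x\<^sub>j\<^sup>2\<close>, both factors \<open>X ^ p - Y ^ p\<close> and \<open>X ^ q - Y ^ q\<close> are
  multiples of \<open>X - Y\<close> with cofactors that have nonnegative coefficients. The product is thus
  \<open>(X - Y)\<^sup>2\<close> times a combination of monomials in squared variables.\<close>

lemma sos_form_power_diff_mult_power_diff:
  fixes i j l :: 3
  assumes "t \<ge> 0" and k: "p + q + r = k"
  shows "sos_form k (\<lambda>x. ((t * (x $ i)\<^sup>2) ^ p - ((x $ j)\<^sup>2) ^ p)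
                       * ((t * (x $ i)\<^sup>2) ^ q - ((x $ j)\<^sup>2) ^ q) * (x $ l) ^ (2 * r))"
    (is "sos_form k ?f")
proof -
  define u where "u a b x = t * ((x $ i) ^ (a + b + 2) * (x $ j) ^ (p - Suc a + (q - Suc b)) * (x $ l) ^ r)
      + (- 1) * ((x $ i) ^ (a + b) * (x $ j) ^ (p - Suc a + (q - Suc b) + 2) * (x $ l) ^ r)"
    for a b and x :: "real ^ 3"
  have u: "homogeneous_polynomial k (u a b)" if "a < p" "b < q" for a b
    unfolding u_def using that k
    by (intro homogeneous_polynomial_add homogeneous_polynomial_scale
        homogeneous_polynomial_monomial) auto
  have "?f x = (\<Sum>a<p. \<Sum>b<q. t ^ (a + b) * (u a b x)\<^sup>2)" for x
  proof -
    define X Y where "X = t * (x $ i)\<^sup>2" and "Y = (x $ j)\<^sup>2"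
    have "t ^ (a + b) * (u a b x)\<^sup>2 =
        (X - Y)\<^sup>2 * (Y ^ (p - Suc a) * X ^ a) * (Y ^ (q - Suc b) * X ^ b) * (x $ l) ^ (2 * r)" for a b
    proof -
      have "u a b x = (X - Y) * (x $ i) ^ a * (x $ i) ^ b * (x $ j) ^ (p - Suc a)
          * (x $ j) ^ (q - Suc b) * (x $ l) ^ r"
        by (simp add: u_def X_def Y_def power_add algebra_simps power2_eq_square)
      moreover have "X ^ n = t ^ n * ((x $ i) ^ n)\<^sup>2" "Y ^ n = ((x $ j) ^ n)\<^sup>2"
        "(x $ l) ^ (2 * n) = ((x $ l) ^ n)\<^sup>2" for n
        by (simp_all add: X_def Y_def power_mult_distrib power_mult[symmetric] mult.commute)
      ultimately show ?thesis
        by (simp only: power_mult_distrib power_add mult_ac)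
    qed
    then have "(\<Sum>a<p. \<Sum>b<q. t ^ (a + b) * (u a b x)\<^sup>2)
        = (X - Y)\<^sup>2 * (\<Sum>a<p. Y ^ (p - Suc a) * X ^ a) * (\<Sum>b<q. Y ^ (q - Suc b) * X ^ b)
          * (x $ l) ^ (2 * r)"
      by (simp add: sum_distrib_left sum_distrib_right mult.assoc) (rule sum.swap)
    also have "\<dots> = ?f x"
      unfolding X_def[symmetric] Y_def[symmetric] power_diff_sumr2[of X] by (simp add: power2_eq_square)
    finally show ?thesis by simp
  qed
  moreover have "sos_form k (\<lambda>x. \<Sum>a<p. \<Sum>b<q. t ^ (a + b) * (u a b x)\<^sup>2)"
    using \<open>t \<ge> 0\<close> u by (intro sos_form_sum sos_form_scale sos_form_square) auto
  ultimately show ?thesis by (simp only:)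
qed

text \<open>Multiplying out the product of differences gives the two-variable inequality
  \<open>X ^ p * Y ^ q + X ^ q * Y ^ p \<le> X ^ (p + q) + Y ^ (p + q)\<close>, and the second summand on the left
  is itself a square, so it can be dropped.\<close>

lemma sos_form_amgm:
  fixes i j l :: 3
  assumes "t \<ge> 0" and k: "p + q + r = k"
  shows "sos_form k (\<lambda>x. (t ^ (p + q) * (x $ i) ^ (2 * (p + q)) + (x $ j) ^ (2 * (p + q))
                       - t ^ p * ((x $ i) ^ (2 * p) * (x $ j) ^ (2 * q))) * (x $ l) ^ (2 * r))"
    (is "sos_form k ?g")
proof -
  have "?g x = ((t * (x $ i)\<^sup>2) ^ p - ((x $ j)\<^sup>2) ^ p) * ((t * (x $ i)\<^sup>2) ^ q - ((x $ j)\<^sup>2) ^ q)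
        * (x $ l) ^ (2 * r) + t ^ q * ((x $ i) ^ (2 * q) * (x $ j) ^ (2 * p) * (x $ l) ^ (2 * r))" for x
  proof -
    have "(P * Q * A * B + C * D - P * (A * D)) * L = (P * A - C) * (Q * B - D) * L + Q * (B * C * L)"
      for P Q A B C D L :: real
      by (simp add: algebra_simps)
    then show ?thesis
      by (simp only: power_mult_distrib power_mult power_add distrib_left mult.assoc)
  qed
  moreover have "sos_form k (\<lambda>x. ((t * (x $ i)\<^sup>2) ^ p - ((x $ j)\<^sup>2) ^ p)
        * ((t * (x $ i)\<^sup>2) ^ q - ((x $ j)\<^sup>2) ^ q)
        * (x $ l) ^ (2 * r) + t ^ q * ((x $ i) ^ (2 * q) * (x $ j) ^ (2 * p) * (x $ l) ^ (2 * r)))"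
    using assms
    by (intro sos_form_add sos_form_power_diff_mult_power_diff sos_form_scale sos_form_even_monomial)
      auto
  ultimately show ?thesis by (simp only:)
qed

section \<open>Forms dominated by the pure powers of the outer variables\<close>

text \<open>In the Hankel form the coefficient of \<open>x\<^sub>2 ^ (2 * k)\<close> is fixed, while that of the other two
  pure powers may be chosen large. Demanding an arbitrarily small multiple of \<open>x\<^sub>2 ^ (2 * k)\<close>
  makes the notion closed under sums, so that the mixed monomials can be treated one at a time.\<close>

definition dominated :: "nat \<Rightarrow> (real ^ 3 \<Rightarrow> real) \<Rightarrow> bool" where
  "dominated k h \<longleftrightarrow> (\<forall>\<epsilon>>0. \<exists>M\<ge>0. sos_form k
     (\<lambda>x. M * ((x $ 1) ^ (2 * k) + (x $ 3) ^ (2 * k)) + \<epsilon> * (x $ 2) ^ (2 * k) + h x))"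

lemma sos_form_imp_dominated:
  assumes "sos_form k h"
  shows "dominated k h"
  unfolding dominated_def
proof (intro allI impI exI[of _ 0] conjI)
  fix \<epsilon> :: real assume "\<epsilon> > 0"
  then have "sos_form k (\<lambda>x. \<epsilon> * (x $ 2) ^ (2 * k) + h x)"
    using assms by (intro sos_form_add sos_form_scale sos_form_even_power) auto
  then show "sos_form k (\<lambda>x. 0 * ((x $ 1) ^ (2 * k) + (x $ 3) ^ (2 * k)) + \<epsilon> * (x $ 2) ^ (2 * k) + h x)"
    by simp
qed auto

lemma dominated_add:
  assumes "dominated k g" and "dominated k h"
  shows "dominated k (\<lambda>x. g x + h x)"
  unfolding dominated_def
proof (intro allI impI)
  fix \<epsilon> :: real assume "\<epsilon> > 0"
  then have "\<epsilon> / 2 > 0" by simp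
  then obtain M N where "M \<ge> 0" "N \<ge> 0"
    and "sos_form k (\<lambda>x. M * ((x $ 1) ^ (2 * k) + (x $ 3) ^ (2 * k)) + \<epsilon> / 2 * (x $ 2) ^ (2 * k) + g x)"
    and "sos_form k (\<lambda>x. N * ((x $ 1) ^ (2 * k) + (x $ 3) ^ (2 * k)) + \<epsilon> / 2 * (x $ 2) ^ (2 * k) + h x)"
    using assms unfolding dominated_def by blast
  from sos_form_add[OF this(3,4)]
  have "sos_form k (\<lambda>x. (M + N) * ((x $ 1) ^ (2 * k) + (x $ 3) ^ (2 * k))
      + \<epsilon> * (x $ 2) ^ (2 * k) + (g x + h x))"
    by (rule back_subst[of "sos_form k"]) (auto simp: algebra_simps)
  then show "\<exists>M\<ge>0. sos_form k (\<lambda>x. M * ((x $ 1) ^ (2 * k) + (x $ 3) ^ (2 * k))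
      + \<epsilon> * (x $ 2) ^ (2 * k) + (g x + h x))"
    using \<open>M \<ge> 0\<close> \<open>N \<ge> 0\<close> by (intro exI[of _ "M + N"]) auto
qed

lemma dominated_sum:
  "(\<And>i. i \<in> I \<Longrightarrow> dominated k (h i)) \<Longrightarrow> dominated k (\<lambda>x. \<Sum>i\<in>I. h i x)"
  by (induction I rule: infinite_finite_induct)
    (auto simp: sos_form_imp_dominated sos_form_zero intro: dominated_add)

lemma dominated_scale:
  assumes "dominated k h" and "c > 0"
  shows "dominated k (\<lambda>x. c * h x)"
  unfolding dominated_def
proof (intro allI impI)
  fix \<epsilon> :: real assume "\<epsilon> > 0"
  then have "\<epsilon> / c > 0" using \<open>c > 0\<close> by simp
  then obtain M where "M \<ge> 0"
    and "sos_form k (\<lambda>x. M * ((x $ 1) ^ (2 * k) + (x $ 3) ^ (2 * k)) + \<epsilon> / c * (x $ 2) ^ (2 * k) + h x)"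
    using assms unfolding dominated_def by blast
  from sos_form_scale[OF this(2), of c]
  have "sos_form k (\<lambda>x. (c * M) * ((x $ 1) ^ (2 * k) + (x $ 3) ^ (2 * k))
      + \<epsilon> * (x $ 2) ^ (2 * k) + c * h x)"
    using \<open>c > 0\<close> by (auto simp: distrib_left mult.assoc)
  then show "\<exists>M\<ge>0. sos_form k (\<lambda>x. M * ((x $ 1) ^ (2 * k) + (x $ 3) ^ (2 * k))
      + \<epsilon> * (x $ 2) ^ (2 * k) + c * h x)"
    using \<open>M \<ge> 0\<close> \<open>c > 0\<close> by (intro exI[of _ "c * M"]) auto
qed

text \<open>Rescaling \<open>x\<^sub>i\<close> by a large factor in the two-variable inequality makes the coefficient of
  \<open>x\<^sub>2 ^ (2 * k)\<close> as small as desired; this needs a positive power of \<open>x\<^sub>i\<close> in the monomial.\<close>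

lemma dominated_neg_square_two_variables:
  fixes i :: 3
  assumes i: "i = 1 \<or> i = 3" and "n > 0" and k: "n + b = k"
  shows "dominated k (\<lambda>x. - ((x $ i) ^ (2 * n) * (x $ 2) ^ (2 * b)))"
  unfolding dominated_def
proof (intro allI impI)
  fix \<epsilon> :: real assume "\<epsilon> > 0"
  define t where "t = 1 + 1 / \<epsilon>"
  have t: "t \<ge> 1" using \<open>\<epsilon> > 0\<close> by (simp add: t_def)
  have "1 / \<epsilon> \<le> t ^ n"
    using self_le_power[OF t \<open>n > 0\<close>] by (simp add: t_def)
  then have eps: "1 / t ^ n \<le> \<epsilon>"
    using \<open>\<epsilon> > 0\<close> t by (simp add: field_simps)
  define i' :: 3 where "i' = (if i = 1 then 3 else 1)"
  have pow: "(x $ 1) ^ (2 * k) + (x $ 3) ^ (2 * k) = (x $ i) ^ (2 * k) + (x $ i') ^ (2 * k)"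
    for x :: "real ^ 3"
    using i by (auto simp: i'_def)
  have "sos_form k (\<lambda>x. (1 / t ^ n) * ((t ^ k * (x $ i) ^ (2 * k) + (x $ 2) ^ (2 * k)
      - t ^ n * ((x $ i) ^ (2 * n) * (x $ 2) ^ (2 * b))) * (x $ 2) ^ (2 * 0))
      + (\<epsilon> - 1 / t ^ n) * (x $ 2) ^ (2 * k) + t ^ b * (x $ i') ^ (2 * k))"
    using sos_form_amgm[of t n b 0 k i 2 2] t k eps
    by (intro sos_form_add sos_form_scale sos_form_even_power) auto
  then have "sos_form k (\<lambda>x. t ^ b * ((x $ i) ^ (2 * k) + (x $ i') ^ (2 * k))
      + \<epsilon> * (x $ 2) ^ (2 * k) + - ((x $ i) ^ (2 * n) * (x $ 2) ^ (2 * b)))"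
    by (rule back_subst[of "sos_form k"]) (use t k in \<open>auto simp: field_simps power_add\<close>)
  then show "\<exists>M\<ge>0. sos_form k (\<lambda>x. M * ((x $ 1) ^ (2 * k) + (x $ 3) ^ (2 * k))
      + \<epsilon> * (x $ 2) ^ (2 * k) + - ((x $ i) ^ (2 * n) * (x $ 2) ^ (2 * b)))"
    using t unfolding pow by (intro exI[of _ "t ^ b"]) auto
qed

text \<open>The powers of \<open>x\<^sub>1\<close> and \<open>x\<^sub>3\<close> are first separated by the two-variable inequality, with the
  power of \<open>x\<^sub>2\<close> as a common factor.\<close>

lemma dominated_neg_square:
  assumes "a + c > 0" and k: "a + b + c = k"
  shows "dominated k (\<lambda>x. - ((x $ 1) ^ a * (x $ 2) ^ b * (x $ 3) ^ c)\<^sup>2)"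
proof -
  have "dominated k (\<lambda>x. (1 ^ (a + c) * (x $ 1) ^ (2 * (a + c)) + (x $ 3) ^ (2 * (a + c))
           - 1 ^ a * ((x $ 1) ^ (2 * a) * (x $ 3) ^ (2 * c))) * (x $ 2) ^ (2 * b)
       + - ((x $ 1) ^ (2 * (a + c)) * (x $ 2) ^ (2 * b))
       + - ((x $ 3) ^ (2 * (a + c)) * (x $ 2) ^ (2 * b)))"
    using assms
    by (intro dominated_add sos_form_imp_dominated sos_form_amgm dominated_neg_square_two_variables)
      auto
  then show ?thesis
    by (rule back_subst[of "dominated k"])
      (auto simp: algebra_simps power_mult_distrib power_mult[symmetric])
qed

text \<open>For even \<open>j\<close> the monomial is a square. In general it is the product \<open>u * w\<close> of two monomials
  of degree \<open>k\<close>, with the powers of \<open>x\<^sub>1\<close> and \<open>x\<^sub>3\<close> split as evenly as possible, and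
  \<open>2 * u * w = (u + w)\<^sup>2 - u\<^sup>2 - w\<^sup>2\<close>.\<close>

lemma dominated_balanced_monomial:
  assumes "0 < j" and "j \<le> k"
  shows "dominated k (\<lambda>x. (x $ 1) ^ j * (x $ 2) ^ (2 * (k - j)) * (x $ 3) ^ j)"
proof -
  define a c where "a = j div 2" and "c = j - j div 2"
  have j: "j = a + c" by (simp add: a_def c_def)
  define u w where "u x = (x $ 1) ^ a * (x $ 2) ^ (k - j) * (x $ 3) ^ c"
    and "w x = (x $ 1) ^ c * (x $ 2) ^ (k - j) * (x $ 3) ^ a" for x :: "real ^ 3"
  have "sos_form k (\<lambda>x. (u x + w x)\<^sup>2)"
    unfolding u_def w_def using assms j
    by (intro sos_form_square homogeneous_polynomial_add homogeneous_polynomial_monomial) auto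
  moreover have "dominated k (\<lambda>x. - (u x)\<^sup>2)" "dominated k (\<lambda>x. - (w x)\<^sup>2)"
    unfolding u_def w_def using assms j by (auto intro!: dominated_neg_square)
  ultimately have "dominated k (\<lambda>x. (1 / 2) * ((u x + w x)\<^sup>2 + - (u x)\<^sup>2 + - (w x)\<^sup>2))"
    by (intro dominated_scale dominated_add) (auto intro: sos_form_imp_dominated)
  moreover have "(1 / 2) * ((u x + w x)\<^sup>2 + - (u x)\<^sup>2 + - (w x)\<^sup>2)
      = (x $ 1) ^ j * (x $ 2) ^ (2 * (k - j)) * (x $ 3) ^ j" for x
  proof -
    have "(1 / 2) * ((u x + w x)\<^sup>2 + - (u x)\<^sup>2 + - (w x)\<^sup>2) = u x * w x"
      by (simp add: power2_eq_square algebra_simps)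
    also have "\<dots> = (x $ 1) ^ j * (x $ 2) ^ (2 * (k - j)) * (x $ 3) ^ j"
      by (simp add: u_def w_def j power_add mult_2)
    finally show ?thesis .
  qed
  ultimately show ?thesis by simp
qed

section \<open>The form of the truncated Hankel tensor\<close>

lemma finite_multi_indices: "finite (multi_indices m)"
  unfolding multi_indices_def by (intro finite_PiE) auto

lemma multi_index_range: "i \<in> multi_indices m \<Longrightarrow> j \<in> {1..m} \<Longrightarrow> i j \<in> {1, 2, 3}"
  unfolding multi_indices_def by (fastforce dest: PiE_mem)

definition const_index :: "nat \<Rightarrow> nat \<Rightarrow> nat \<Rightarrow> nat" where
  "const_index m n = (\<lambda>j\<in>{1..m}. n)"

lemma const_index_in_multi_indices: "n \<in> {1..3} \<Longrightarrow> const_index m n \<in> multi_indices m"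
  unfolding const_index_def multi_indices_def by auto

lemma multi_index_eq_const_index:
  assumes "i \<in> multi_indices m" and "\<And>j. j \<in> {1..m} \<Longrightarrow> i j = n"
  shows "i = const_index m n"
  using assms unfolding multi_indices_def const_index_def by (auto simp: fun_eq_iff PiE_def extensional_def)

lemma multi_index_sum_ge: "i \<in> multi_indices m \<Longrightarrow> m \<le> (\<Sum>j=1..m. i j)"
  using sum_mono[of "{1..m}" "\<lambda>_. 1" i] by (fastforce dest: multi_index_range)

lemma multi_index_sum_eq_minimal:
  assumes i: "i \<in> multi_indices m" and "(\<Sum>j=1..m. i j) = m"
  shows "i = const_index m 1"
proof (rule multi_index_eq_const_index[OF i])
  have "(\<Sum>j=1..m. i j - 1) = 0"
    using assms by (subst sum_subtractf_nat) (fastforce dest: multi_index_range)+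
  then have "i j - 1 = 0" if "j \<in> {1..m}" for j
    using that by simp
  then show "i j = 1" if "j \<in> {1..m}" for j
    using that multi_index_range[OF i that] by fastforce
qed

lemma multi_index_sum_eq_maximal:
  assumes i: "i \<in> multi_indices m" and "(\<Sum>j=1..m. i j) = 3 * m"
  shows "i = const_index m 3"
proof (rule multi_index_eq_const_index[OF i])
  have "(\<Sum>j=1..m. 3 - i j) = 0"
    using assms by (subst sum_subtractf_nat) (fastforce dest: multi_index_range)+
  then have "3 - i j = 0" if "j \<in> {1..m}" for j
    using that by simp
  then show "i j = 3" if "j \<in> {1..m}" for j
    using that multi_index_range[OF i that] by fastforce
qed

text \<open>If \<open>n\<^sub>1\<close>, \<open>n\<^sub>2\<close>, \<open>n\<^sub>3\<close> count the entries equal to \<open>1\<close>, \<open>2\<close>, \<open>3\<close>, then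
  \<open>n\<^sub>1 + n\<^sub>2 + n\<^sub>3 = m\<close> and \<open>n\<^sub>1 + 2 * n\<^sub>2 + 3 * n\<^sub>3 = 2 * m\<close>, hence \<open>n\<^sub>1 = n\<^sub>3\<close>: along the middle
  antidiagonal the powers of \<open>x\<^sub>1\<close> and \<open>x\<^sub>3\<close> agree.\<close>

lemma middle_index_monomial:
  assumes i: "i \<in> multi_indices (2 * k)" and sum_i: "(\<Sum>j=1..2 * k. i j) = 4 * k"
    and "i \<noteq> const_index (2 * k) 2"
  obtains n where "0 < n" "n \<le> k"
    and "\<And>x :: real ^ 3. (\<Prod>j=1..2 * k. x $ of_nat (i j)) = (x $ 1) ^ n * (x $ 2) ^ (2 * (k - n)) * (x $ 3) ^ n"
proof -
  define J where "J v = {j \<in> {1..2 * k}. i j = v}" for v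
  have range: "i ` {1..2 * k} \<subseteq> {1, 2, 3}"
    using multi_index_range[OF i] by blast
  have "(\<Sum>v\<in>{1, 2, 3}. \<Sum>j\<in>J v. 1) = (\<Sum>j=1..2 * k. 1 :: nat)"
    unfolding J_def using range by (intro sum.group) auto
  then have total: "card (J 1) + card (J 2) + card (J 3) = 2 * k" by simp
  have "(\<Sum>v\<in>{1, 2, 3}. \<Sum>j\<in>J v. i j) = (\<Sum>j=1..2 * k. i j)"
    unfolding J_def using range by (intro sum.group) auto
  moreover have "(\<Sum>j\<in>J v. i j) = card (J v) * v" for v
    by (simp add: J_def)
  ultimately have "card (J 1) + 2 * card (J 2) + 3 * card (J 3) = 4 * k"
    using sum_i by simp
  with total have n: "card (J 3) = card (J 1)" "card (J 1) \<le> k" "card (J 2) = 2 * (k - card (J 1))"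
    by auto
  have "card (J 1) \<noteq> 0"
  proof
    assume "card (J 1) = 0"
    moreover have "finite (J v)" for v by (simp add: J_def)
    ultimately have "J 1 = {}" "J 3 = {}" using n by auto
    then have "i j = 2" if "j \<in> {1..2 * k}" for j
      using multi_index_range[OF i that] that by (auto simp: J_def)
    with assms show False using multi_index_eq_const_index[OF i] by blast
  qed
  moreover have "(\<Prod>j=1..2 * k. x $ of_nat (i j))
      = (x $ 1) ^ card (J 1) * (x $ 2) ^ (2 * (k - card (J 1))) * (x $ 3) ^ card (J 1)" for x :: "real ^ 3"
  proof -
    have "(\<Prod>v\<in>{1, 2, 3}. \<Prod>j\<in>J v. x $ of_nat (i j)) = (\<Prod>j=1..2 * k. x $ of_nat (i j))"
      unfolding J_def using range by (intro prod.group) auto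
    moreover have "(\<Prod>j\<in>J v. x $ of_nat (i j)) = (x $ of_nat v) ^ card (J v)" for v
      by (simp add: J_def)
    ultimately show ?thesis using n by (simp add: mult.assoc)
  qed
  ultimately show ?thesis using n that by blast
qed

definition middle_indices :: "nat \<Rightarrow> (nat \<Rightarrow> nat) set" where
  "middle_indices m = {i \<in> multi_indices m. (\<Sum>j=1..m. i j) = 2 * m}"

lemma tensor_form_truncated_hankel:
  assumes "m > 0"
  shows "tensor_form m (\<A> m vm v0) x = v0 * ((x $ 1) ^ m + (x $ 3) ^ m)
    + vm * ((x $ 2) ^ m + (\<Sum>i\<in>middle_indices m - {const_index m 2}. \<Prod>j=1..m. x $ of_nat (i j)))"
proof -
  define X where "X i = (\<Prod>j=1..m. x $ of_nat (i j))" for i :: "nat \<Rightarrow> nat"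
  have X_const: "X (const_index m n) = (x $ of_nat n) ^ m" for n
    by (simp add: X_def const_index_def)
  have sum_const: "(\<Sum>j=1..m. const_index m n j) = n * m" for n
    by (simp add: const_index_def)
  have entry: "\<A> m vm v0 i = (if i = const_index m 1 then v0 else 0)
      + (if i = const_index m 3 then v0 else 0) + (if i \<in> middle_indices m then vm else 0)"
    if i: "i \<in> multi_indices m" for i
  proof -
    have "i = const_index m 1 \<longleftrightarrow> (\<Sum>j=1..m. i j) = m"
      using multi_index_sum_eq_minimal[OF i] sum_const[of 1] by auto
    moreover have "i = const_index m 3 \<longleftrightarrow> (\<Sum>j=1..m. i j) = 3 * m"
      using multi_index_sum_eq_maximal[OF i] sum_const[of 3] by auto
    ultimately show ?thesis
      using multi_index_sum_ge[OF i] \<open>m > 0\<close> i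
      by (auto simp: \<A>_def hankel_tensor_def truncated_vector_def middle_indices_def)
  qed
  have "tensor_form m (\<A> m vm v0) x = (\<Sum>i\<in>multi_indices m.
      (if i = const_index m 1 then v0 * X i else 0)
      + (if i = const_index m 3 then v0 * X i else 0)
      + (if i \<in> middle_indices m then vm * X i else 0))"
    unfolding tensor_form_def X_def[symmetric] by (intro sum.cong) (auto simp: entry algebra_simps)
  also have "\<dots> = v0 * X (const_index m 1) + v0 * X (const_index m 3) + vm * (\<Sum>i\<in>middle_indices m. X i)"
    by (simp add: sum.distrib finite_multi_indices const_index_in_multi_indices sum_distrib_left
        middle_indices_def sum.inter_filter if_distrib[of "(*) vm"] cong: if_cong)
  also have "(\<Sum>i\<in>middle_indices m. X i) = X (const_index m 2) + (\<Sum>i\<in>middle_indices m - {const_index m 2}. X i)"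
    using sum_const[of 2]
    by (intro sum.remove) (auto simp: middle_indices_def finite_multi_indices const_index_in_multi_indices)
  finally show ?thesis
    unfolding X_def[symmetric] by (simp add: X_const distrib_left)
qed

lemma sos_tensor_truncated_hankel:
  assumes "k > 0"
  obtains M where "M \<ge> 0"
    and "\<And>vm v0. vm \<ge> 0 \<Longrightarrow> v0 \<ge> M * vm \<Longrightarrow> sos_tensor (2 * k) (\<A> (2 * k) vm v0)"
proof -
  define R where "R x = (\<Sum>i\<in>middle_indices (2 * k) - {const_index (2 * k) 2}.
    \<Prod>j=1..2 * k. x $ of_nat (i j))" for x :: "real ^ 3"
  have "dominated k R"
    unfolding R_def
  proof (rule dominated_sum)
    fix i assume "i \<in> middle_indices (2 * k) - {const_index (2 * k) 2}"
    then have "i \<in> multi_indices (2 * k)" "(\<Sum>j=1..2 * k. i j) = 4 * k" "i \<noteq> const_index (2 * k) 2"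
      by (auto simp: middle_indices_def)
    then obtain n where "0 < n" "n \<le> k" and "\<And>x :: real ^ 3. (\<Prod>j=1..2 * k. x $ of_nat (i j))
        = (x $ 1) ^ n * (x $ 2) ^ (2 * (k - n)) * (x $ 3) ^ n"
      using middle_index_monomial by metis
    then show "dominated k (\<lambda>x. \<Prod>j=1..2 * k. x $ of_nat (i j))"
      using dominated_balanced_monomial by (simp only:)
  qed
  then obtain M where "M \<ge> 0"
    and M: "sos_form k (\<lambda>x. M * ((x $ 1) ^ (2 * k) + (x $ 3) ^ (2 * k)) + 1 * (x $ 2) ^ (2 * k) + R x)"
    unfolding dominated_def using zero_less_one by blast
  have "sos_tensor (2 * k) (\<A> (2 * k) vm v0)" if "vm \<ge> 0" "v0 \<ge> M * vm" for vm v0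
  proof -
    have "sos_form k (\<lambda>x. (v0 - M * vm) * ((x $ 1) ^ (2 * k) + (x $ 3) ^ (2 * k))
        + vm * (M * ((x $ 1) ^ (2 * k) + (x $ 3) ^ (2 * k)) + 1 * (x $ 2) ^ (2 * k) + R x))"
      using that by (intro sos_form_add[OF sos_form_scale sos_form_scale[OF M]]
          sos_form_add sos_form_even_power) auto
    then have "sos_form k (tensor_form (2 * k) (\<A> (2 * k) vm v0))"
      by (rule back_subst[of "sos_form k"])
        (use assms in \<open>simp add: fun_eq_iff tensor_form_truncated_hankel R_def ring_distribs\<close>)
    then show ?thesis by (simp add: sos_tensor_iff_sos_form)
  qed
  with \<open>M \<ge> 0\<close> show ?thesis using that by blast
qed

lemma sos_tensor_imp_psd_tensor: "sos_tensor m a \<Longrightarrow> psd_tensor m a"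
  unfolding sos_tensor_def psd_tensor_def by (auto intro!: sum_list_nonneg)

section \<open>The two critical values\<close>

lemma d\<^sub>2_nonneg: "0 \<le> d\<^sub>2 m vm"
  unfolding d\<^sub>2_def by (auto intro!: Inf_greatest)

lemma d\<^sub>2_le_d\<^sub>1: "d\<^sub>2 m vm \<le> d\<^sub>1 m vm"
  unfolding d\<^sub>1_def d\<^sub>2_def by (auto intro!: Inf_superset_mono sos_tensor_imp_psd_tensor)

lemma d\<^sub>1_le:
  assumes "d > 0" and "\<And>v0. v0 \<ge> 0 \<Longrightarrow> v0 \<ge> d * vm \<Longrightarrow> sos_tensor m (\<A> m vm v0)"
  shows "d\<^sub>1 m vm \<le> ereal d"
  unfolding d\<^sub>1_def using assms by (intro Inf_lower) auto

theorem theorem1: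
  fixes m :: nat and vm :: real
  assumes "m \<ge> 6" and "even m" and "vm \<ge> 0"
  shows "(vm = 0 \<longrightarrow> d\<^sub>2 m vm = 0 \<and> d\<^sub>1 m vm = 0) \<and>
         (vm > 0 \<longrightarrow> 0 \<le> d\<^sub>2 m vm \<and> d\<^sub>2 m vm \<le> d\<^sub>1 m vm \<and> d\<^sub>1 m vm < \<infinity>)"
proof -
  obtain k where m: "m = 2 * k" using \<open>even m\<close> by blast
  then have "k > 0" using \<open>m \<ge> 6\<close> by simp
  from sos_tensor_truncated_hankel[OF this] obtain M where "M \<ge> 0"
    and sos: "\<And>vm v0. vm \<ge> 0 \<Longrightarrow> v0 \<ge> M * vm \<Longrightarrow> sos_tensor m (\<A> m vm v0)"
    unfolding m by blast
  have "d\<^sub>1 m 0 \<le> 0"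
  proof (rule ereal_le_epsilon2)
    fix e :: real assume "0 < e"
    then show "d\<^sub>1 m 0 \<le> 0 + ereal e"
      using d\<^sub>1_le[of e 0 m] sos[of 0] by simp
  qed
  \<comment> \<open>The bound has to be positive, while \<open>M\<close> may be \<open>0\<close>.\<close>
  moreover have "d\<^sub>1 m vm \<le> ereal (M + 1)"
  proof (rule d\<^sub>1_le)
    fix v0 assume "v0 \<ge> (M + 1) * vm"
    then show "sos_tensor m (\<A> m vm v0)"
      using \<open>vm \<ge> 0\<close> by (intro sos) (auto simp: distrib_right)
  qed (use \<open>M \<ge> 0\<close> in simp)
  then have "d\<^sub>1 m vm < \<infinity>"
    by (rule order.strict_trans1) simp
  ultimately show ?thesis
    using d\<^sub>2_nonneg[of m vm] d\<^sub>2_le_d\<^sub>1[of m vm] by (auto intro: antisym order.trans)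
qed

end
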